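(* Let $A=(a_{j,k})_{j,k\ge1}$ be a matrix with $a_{j,k}\ge0$ for all $j,k$ which is row decreasing, i.e. $a_{j,k}\ge a_{j,k+1}$ for all $j,k\ge1$. Then: (a) Let $(E,\|\cdot\|_E)$, $(F,\|\cdot\|_F)$ be normed Riesz spaces of real sequences with property $(PS)$, with $\|x\|_F=\lim_{n\to\infty}\|P_nx\|_F$ for all $x\in F$, and suppose $A$ defines an operator from $E$ to $F$. Then $\|Ax^*\|_F\ge\|Ax\|_F$ for all $x\in E$ with $x\ge0$, and hence $\|A\|_{E,F}=\|A\|_{E,F,\downarrow}$. (b) Let $1\le p<\infty$, let $v_1\ge v_2\ge\cdots\ge0$, and let $(E,\|\cdot\|_E)$ be a normed Riesz space of real sequences with property $(PS)$. Then $\|Ax^*\|_{\ell_p(v)}\ge\|Ax\|_{\ell_p(v)}$ for all $x\in E$ with $x\ge0$, and hence $\|A\|_{E,\ell_p(v)}=\|A\|_{E,\ell_p(v),\downarrow}$.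
   Context: Decreasing means non-increasing; $x\ge0$ means $x_k\ge0$ for all $k$. For a real sequence $x$, $x^*$ denotes the decreasing rearrangement of $\{|x_k|\}$: $x_n^*$ is the $n$-th largest of the numbers $|x_k|$ counted with multiplicity, i.e. $x_n^*=\max_{|N|=n}\min_{k\in N}|x_k|$ over sets $N$ of $n$ indices; $x^*$ exists if all these maxima exist. $P_nx=(x_1,\dots,x_n,0,0,\dots)$. A normed Riesz space of real sequences is a vector space of real sequences that is a vector lattice under the coordinatewise order and operations, with a norm such that $|x|\le|y|$ coordinatewise implies $\|x\|\le\|y\|$. Such a space $F$ has property $(PS)$ if for every $x\in F$ the sequence $x^*$ exists, and whenever $y$ is a real sequence for which $y^*$ exists and $y_1^*+\cdots+y_n^*\le x_1^*+\cdots+x_n^*$ for all $n\ge1$, then $y\in F$ and $\|y\|_F\le\|x\|_F$. A matrix $A=(a_{j,k})$ acts by $(Ax)_j=\sum_{k=1}^\infty a_{j,k}x_k$. In (a), $\|A\|_{E,F}=\sup_{\|x\|_E=1}\|Ax\|_F$ and $\|A\|_{E,F,\downarrow}=\sup\{\|Ax\|_F:\|x\|_E=1,\ x\ge0,\ x\text{ decreasing}\}$. In (b), $\|y\|_{\ell_p(v)}=\left(\sum_{k=1}^\infty|y_k|^pv_k\right)^{1/p}$; for $x\ge0$, $(Ax)_j\in[0,\infty]$ and $\|Ax\|_{\ell_p(v)}\in[0,\infty]$ with $0\cdot\infty=0$; since $A\ge0$ its norm is determined by non-negative sequences, $\|A\|_{E,\ell_p(v)}=\sup\{\|Ax\|_{\ell_p(v)}:\|x\|_E=1,\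 x\ge0\}$, and $\|A\|_{E,\ell_p(v),\downarrow}$ is the same supremum restricted to decreasing $x$. All norms may be $\infty$. *)

theory Defs
  imports "HOL-Analysis.Analysis"
begin

text \<open>
  Real sequences are functions on \<^typ>\<open>nat\<close>; the index \<open>k\<close> stands for the mathematical index
  \<open>k + 1\<close>, so sequences, matrices, weights and rearrangements all start at \<open>0\<close>.
\<close>

definition rearr_candidates :: "(nat \<Rightarrow> real) \<Rightarrow> nat \<Rightarrow> real set" where
  "rearr_candidates x n = {Min ((\<lambda>k. \<bar>x k\<bar>) ` N) | N. finite N \<and> card N = Suc n}"

definition rearr_exists :: "(nat \<Rightarrow> real) \<Rightarrow> bool" where
  "rearr_exists x \<longleftrightarrow>
     (\<forall>n. \<exists>m\<in>rearr_candidates x n. \<forall>t\<in>rearr_candidates x n. t \<le> m)"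

text \<open>
  The decreasing rearrangement \<open>x\<^sup>*\<close>: \<open>rearr x n\<close> is the \<open>(n + 1)\<close>-th largest of the \<open>\<bar>x k\<bar>\<close>.
  It is only meaningful when \<^term>\<open>rearr_exists x\<close> holds. Each \<^term>\<open>rearr_candidates x n\<close> may be
  infinite, so \<^const>\<open>Max\<close> is not applicable here.
\<close>

definition rearr :: "(nat \<Rightarrow> real) \<Rightarrow> nat \<Rightarrow> real" where
  "rearr x n = (GREATEST m. m \<in> rearr_candidates x n)"

definition trunc :: "nat \<Rightarrow> (nat \<Rightarrow> real) \<Rightarrow> nat \<Rightarrow> real" where
  "trunc n x = (\<lambda>k. if k < n then x k else 0)"

text \<open>The norm \<open>nrm\<close> is a total function; only its values on the carrier \<open>E\<close> are constrained.\<close>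

locale normed_riesz_seq_space =
  fixes E :: "(nat \<Rightarrow> real) set" and nrm :: "(nat \<Rightarrow> real) \<Rightarrow> real"
  assumes zero_mem: "(\<lambda>_. 0) \<in> E"
    and add_mem: "x \<in> E \<Longrightarrow> y \<in> E \<Longrightarrow> (\<lambda>k. x k + y k) \<in> E"
    and scale_mem: "x \<in> E \<Longrightarrow> (\<lambda>k. c * x k) \<in> E"
    and sup_mem: "x \<in> E \<Longrightarrow> y \<in> E \<Longrightarrow> (\<lambda>k. max (x k) (y k)) \<in> E"
    and inf_mem: "x \<in> E \<Longrightarrow> y \<in> E \<Longrightarrow> (\<lambda>k. min (x k) (y k)) \<in> E"
    and nrm_nonneg: "x \<in> E \<Longrightarrow> 0 \<le> nrm x"
    and nrm_eq_0_iff: "x \<in> E \<Longrightarrow> nrm x = 0 \<longleftrightarrow> x = (\<lambda>_. 0)"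
    and nrm_scale: "x \<in> E \<Longrightarrow> nrm (\<lambda>k. c * x k) = \<bar>c\<bar> * nrm x"
    and nrm_triangle: "x \<in> E \<Longrightarrow> y \<in> E \<Longrightarrow> nrm (\<lambda>k. x k + y k) \<le> nrm x + nrm y"
    and nrm_mono: "x \<in> E \<Longrightarrow> y \<in> E \<Longrightarrow> (\<And>k. \<bar>x k\<bar> \<le> \<bar>y k\<bar>) \<Longrightarrow> nrm x \<le> nrm y"

definition property_PS :: "(nat \<Rightarrow> real) set \<Rightarrow> ((nat \<Rightarrow> real) \<Rightarrow> real) \<Rightarrow> bool" where
  "property_PS F nF \<longleftrightarrow>
     (\<forall>x\<in>F. rearr_exists x \<and>
        (\<forall>y. rearr_exists y \<and> (\<forall>n. (\<Sum>k<n. rearr y k) \<le> (\<Sum>k<n. rearr x k))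
           \<longrightarrow> y \<in> F \<and> nF y \<le> nF x))"

definition mat_apply :: "(nat \<Rightarrow> nat \<Rightarrow> real) \<Rightarrow> (nat \<Rightarrow> real) \<Rightarrow> nat \<Rightarrow> real" where
  "mat_apply A x j = (\<Sum>k. A j k * x k)"

definition defines_operator ::
    "(nat \<Rightarrow> nat \<Rightarrow> real) \<Rightarrow> (nat \<Rightarrow> real) set \<Rightarrow> (nat \<Rightarrow> real) set \<Rightarrow> bool" where
  "defines_operator A E F \<longleftrightarrow>
     (\<forall>x\<in>E. (\<forall>j. summable (\<lambda>k. A j k * x k)) \<and> mat_apply A x \<in> F)"

text \<open>
  Operator norms are suprema in \<open>[0, \<infinity>]\<close>; over the empty set (when \<open>E\<close> is trivial) they are \<open>0\<close>.
\<close>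

definition op_norm :: "(nat \<Rightarrow> nat \<Rightarrow> real) \<Rightarrow> (nat \<Rightarrow> real) set \<Rightarrow> ((nat \<Rightarrow> real) \<Rightarrow> real) \<Rightarrow>
    ((nat \<Rightarrow> real) \<Rightarrow> real) \<Rightarrow> ennreal" where
  "op_norm A E nE nF = (SUP x\<in>{x \<in> E. nE x = 1}. ennreal (nF (mat_apply A x)))"

definition op_norm_decr :: "(nat \<Rightarrow> nat \<Rightarrow> real) \<Rightarrow> (nat \<Rightarrow> real) set \<Rightarrow> ((nat \<Rightarrow> real) \<Rightarrow> real) \<Rightarrow>
    ((nat \<Rightarrow> real) \<Rightarrow> real) \<Rightarrow> ennreal" where
  "op_norm_decr A E nE nF =
     (SUP x\<in>{x \<in> E. nE x = 1 \<and> (\<forall>k. 0 \<le> x k) \<and> decseq x}. ennreal (nF (mat_apply A x)))"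

text \<open>
  The extended-valued \<open>\<ell>\<^sub>p(v)\<close> setting, for \<open>A \<ge> 0\<close>, \<open>v \<ge> 0\<close> and \<open>x \<ge> 0\<close> only (\<^const>\<open>ennreal\<close> sends
  negative reals to \<open>0\<close>). The power is used for positive exponents; multiplication on
  \<^typ>\<open>ennreal\<close> satisfies \<open>0 * \<infinity> = 0\<close>.
\<close>

definition enn_powr :: "ennreal \<Rightarrow> real \<Rightarrow> ennreal" where
  "enn_powr t p = (if t = \<infinity> then \<infinity> else ennreal (enn2real t powr p))"

definition mat_apply_enn :: "(nat \<Rightarrow> nat \<Rightarrow> real) \<Rightarrow> (nat \<Rightarrow> real) \<Rightarrow> nat \<Rightarrow> ennreal" where
  "mat_apply_enn A x j = (\<Sum>k. ennreal (A j k * x k))"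

definition lp_norm :: "real \<Rightarrow> (nat \<Rightarrow> real) \<Rightarrow> (nat \<Rightarrow> ennreal) \<Rightarrow> ennreal" where
  "lp_norm p v y = enn_powr (\<Sum>k. enn_powr (y k) p * ennreal (v k)) (1 / p)"

definition op_norm_lp :: "(nat \<Rightarrow> nat \<Rightarrow> real) \<Rightarrow> (nat \<Rightarrow> real) set \<Rightarrow> ((nat \<Rightarrow> real) \<Rightarrow> real) \<Rightarrow>
    real \<Rightarrow> (nat \<Rightarrow> real) \<Rightarrow> ennreal" where
  "op_norm_lp A E nE p v =
     (SUP x\<in>{x \<in> E. nE x = 1 \<and> (\<forall>k. 0 \<le> x k)}. lp_norm p v (mat_apply_enn A x))"

definition op_norm_lp_decr :: "(nat \<Rightarrow> nat \<Rightarrow> real) \<Rightarrow> (nat \<Rightarrow> real) set \<Rightarrow> ((nat \<Rightarrow> real) \<Rightarrow> real) \<Rightarrow>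
    real \<Rightarrow> (nat \<Rightarrow> real) \<Rightarrow> ennreal" where
  "op_norm_lp_decr A E nE p v =
     (SUP x\<in>{x \<in> E. nE x = 1 \<and> (\<forall>k. 0 \<le> x k) \<and> decseq x}. lp_norm p v (mat_apply_enn A x))"

end

theory Submission
  imports Defs
begin

text \<open>
  Since the rows of \<open>A\<close> are nonnegative and decreasing, and the partial sums of \<open>\<bar>x\<bar>\<close> are dominated
  by those of \<open>x\<^sup>*\<close>, summation by parts gives \<open>\<bar>Ax\<bar> \<le> Ax\<^sup>*\<close> in every coordinate, so each monotone
  norm satisfies the inequality. The operator norms agree because \<open>x\<^sup>*\<close> lies in \<open>E\<close> with the same
  norm as \<open>x\<close>, by applying property \<open>(PS)\<close> in both directions.
\<close>

text \<open>For general \<open>x\<close> this is the access point to the \<open>GREATEST\<close> in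
  \<open>rearr\<close>: once each maximum is attained, \<open>rearr x n\<close> is itself a
  candidate and bounds all others.\<close>

lemma rearr_greatest:
  assumes "rearr_exists x"
  shows "rearr x n \<in> rearr_candidates x n"
    and "t \<in> rearr_candidates x n \<Longrightarrow> t \<le> rearr x n"
proof -
  obtain m where "m \<in> rearr_candidates x n" "\<And>t. t \<in> rearr_candidates x n \<Longrightarrow> t \<le> m"
    using assms unfolding rearr_exists_def by blast
  moreover from this have "rearr x n = m"
    unfolding rearr_def by (intro Greatest_equality)
  ultimately show "rearr x n \<in> rearr_candidates x n"
    and "t \<in> rearr_candidates x n \<Longrightarrow> t \<le> rearr x n"
    by auto
qed

lemma rearr_nonneg:
  assumes "rearr_exists x"
  shows "0 \<le> rearr x n"
proof -
  obtain N where N: "finite N" "card N = Suc n" "rearr x n = Min ((\<lambda>k. \<bar>x k\<bar>) ` N)"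
    using rearr_greatest(1)[OF assms] unfolding rearr_candidates_def by blast
  then have "N \<noteq> {}"
    by auto
  with N show ?thesis
    by simp
qed

lemma decseq_rearr:
  assumes "rearr_exists x"
  shows "decseq (rearr x)"
proof (rule decseq_SucI)
  fix n
  obtain N where N: "finite N" "card N = Suc (Suc n)"
      "rearr x (Suc n) = Min ((\<lambda>k. \<bar>x k\<bar>) ` N)"
    using rearr_greatest(1)[OF assms] unfolding rearr_candidates_def by blast
  \<comment> \<open>Discarding one index from the maximizing set \<open>N\<close> can only raise the
    minimum, and the smaller set \<open>M\<close> competes for \<open>rearr x n\<close>.\<close>
  obtain M where M: "M \<subseteq> N" "card M = Suc n" "finite M"
    using obtain_subset_with_card_n[of "Suc n" N] N by auto
  then have "M \<noteq> {}"
    by auto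
  have "rearr x (Suc n) \<le> Min ((\<lambda>k. \<bar>x k\<bar>) ` M)"
    unfolding N(3) using M N(1) \<open>M \<noteq> {}\<close> by (intro Min_antimono) auto
  also have "\<dots> \<le> rearr x n"
    using M by (intro rearr_greatest(2)[OF assms]) (auto simp: rearr_candidates_def)
  finally show "rearr x (Suc n) \<le> rearr x n" .
qed

text \<open>Induction that splits off an index of \<open>N\<close> where \<bar>x\<bar> is smallest:
  this minimum over \<open>Suc n\<close> indices is a candidate for \<open>rearr x n\<close>, and
  the other \<open>n\<close> indices fall under the induction hypothesis.\<close>

lemma sum_abs_le_sum_rearr:
  assumes "rearr_exists x"
  shows "finite N \<Longrightarrow> card N = n \<Longrightarrow> (\<Sum>k\<in>N. \<bar>x k\<bar>) \<le> (\<Sum>k<n. rearr x k)"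
proof (induction n arbitrary: N)
  case 0
  then show ?case
    by simp
next
  case (Suc n)
  then have "N \<noteq> {}"
    by auto
  then have "Min ((\<lambda>k. \<bar>x k\<bar>) ` N) \<in> (\<lambda>k. \<bar>x k\<bar>) ` N"
    using Suc.prems by (intro Min_in) auto
  then obtain a where a: "a \<in> N" "\<bar>x a\<bar> = Min ((\<lambda>k. \<bar>x k\<bar>) ` N)"
    by auto
  have "\<bar>x a\<bar> \<le> rearr x n"
    unfolding a(2) using Suc.prems
    by (intro rearr_greatest(2)[OF assms]) (auto simp: rearr_candidates_def)
  moreover have "(\<Sum>k\<in>N - {a}. \<bar>x k\<bar>) \<le> (\<Sum>k<n. rearr x k)"
    using Suc a by (intro Suc.IH) auto
  ultimately show ?case
    using Suc.prems a(1) by (simp add: sum.remove[of N a])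
qed

lemma rearr_of_decseq:
  assumes "decseq y" "\<And>k. 0 \<le> y k"
  shows "rearr_exists y" "rearr y = y"
proof -
  have attained: "y n \<in> rearr_candidates y n" for n
  proof -
    \<comment> \<open>The initial segment \<open>{..n}\<close> has \<open>Suc n\<close> elements,
      and a decreasing sequence is smallest at its last index.\<close>
    have "Min ((\<lambda>k. \<bar>y k\<bar>) ` {..n}) = y n"
      using assms by (intro Min_eqI) (auto simp: decseq_def)
    then show ?thesis
      unfolding rearr_candidates_def by (smt (verit) card_atMost finite_atMost mem_Collect_eq)
  qed
  have bound: "t \<le> y n" if t: "t \<in> rearr_candidates y n" for t n
  proof -
    obtain N where N: "finite N" "card N = Suc n" "t = Min ((\<lambda>k. \<bar>y k\<bar>) ` N)"
      using t unfolding rearr_candidates_def by blast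
    \<comment> \<open>Pigeonhole: \<open>Suc n\<close> distinct indices cannot all lie below
      \<open>n\<close>, so some \<open>k \<ge> n\<close> occurs in \<open>N\<close>, and there
      \<open>y k \<le> y n\<close>.\<close>
    have "card N \<le> n" if "N \<subseteq> {..<n}"
      using card_mono[OF finite_lessThan that] by simp
    then obtain k where k: "k \<in> N" "n \<le> k"
      using N(2) by (fastforce simp: subset_iff)
    have "t \<le> \<bar>y k\<bar>"
      unfolding N(3) using N(1) k(1) by (intro Min_le) auto
    also have "\<dots> \<le> y n"
      using assms k by (simp add: decseqD)
    finally show ?thesis .
  qed
  show "rearr_exists y"
    unfolding rearr_exists_def using attained bound by blast
  show "rearr y = y"
    unfolding rearr_def using attained bound by (intro ext Greatest_equality)
qed

text \<open>Since \<open>rearr\<close> fixes \<open>rearr x\<close>, the sequences \<open>x\<close>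
  and \<open>rearr x\<close> have the same rearrangement, and the partial sum condition of (PS)
  holds with equality both ways. The first use puts \<open>rearr x\<close> into \<open>E\<close>,
  which the second use requires.\<close>

lemma property_PS_rearr:
  assumes "property_PS E nE" "x \<in> E"
  shows "rearr_exists x" "rearr x \<in> E" "nE (rearr x) = nE x"
proof -
  show ex: "rearr_exists x"
    using assms unfolding property_PS_def by blast
  note idem = rearr_of_decseq[OF decseq_rearr[OF ex] rearr_nonneg[OF ex]]
  have PS: "y \<in> E \<and> nE y \<le> nE z"
    if "z \<in> E" "rearr_exists y" "rearr y = rearr z" for y z
    using assms(1) that unfolding property_PS_def by (metis order_refl)
  have "rearr x \<in> E \<and> nE (rearr x) \<le> nE x"
    by (rule PS[OF assms(2) idem])
  moreover from this have "nE x \<le> nE (rearr x)"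
    using PS[of "rearr x" x] ex idem(2) by simp
  ultimately show "rearr x \<in> E" "nE (rearr x) = nE x"
    by auto
qed

lemma sum_mult_mono_of_partial_sums:
  fixes a x y :: "nat \<Rightarrow> real"
  assumes "decseq a" "\<And>k. 0 \<le> a k"
    and "\<And>n. (\<Sum>k<n. x k) \<le> (\<Sum>k<n. y k)"
  shows "(\<Sum>k<n. a k * x k) \<le> (\<Sum>k<n. a k * y k)"
proof -
  define D where "D n = (\<Sum>k<n. y k) - (\<Sum>k<n. x k)" for n
  have D_nonneg: "0 \<le> D n" for n
    using assms(3) by (simp add: D_def)
  \<comment> \<open>By Abel summation the right side equals \<open>a n * D n\<close> plus the sum
    over \<open>k < n\<close> of \<open>(a k - a (Suc k)) * D (Suc k)\<close>, whose terms are
    nonnegative. Keeping the boundary term makes the induction go through.\<close>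
  have "a n * D n \<le> (\<Sum>k<n. a k * y k) - (\<Sum>k<n. a k * x k)"
  proof (induction n)
    case 0
    then show ?case
      by (simp add: D_def)
  next
    case (Suc n)
    have "a (Suc n) * D (Suc n) \<le> a n * D (Suc n)"
      using assms(1) D_nonneg by (intro mult_right_mono) (auto simp: decseq_Suc_iff)
    also have "\<dots> = a n * D n + a n * (y n - x n)"
      by (simp add: D_def algebra_simps)
    finally show ?case
      using Suc.IH by (simp add: algebra_simps)
  qed
  then show ?thesis
    using mult_nonneg_nonneg[OF assms(2)[of n] D_nonneg[of n]] by linarith
qed

lemma sum_mult_abs_le_rearr:
  assumes "rearr_exists x" "decseq a" "\<And>k. 0 \<le> a k"
  shows "(\<Sum>k<n. a k * \<bar>x k\<bar>) \<le> (\<Sum>k<n. a k * rearr x k)"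
  using assms sum_abs_le_sum_rearr[OF assms(1), of "{..<n}" n for n]
  by (intro sum_mult_mono_of_partial_sums) auto

text \<open>The bound holds for every partial sum and passes to the limit. Signed \<open>x\<close>
  is covered because \<open>op_norm\<close> ranges over all unit vectors.\<close>

lemma abs_mat_apply_le_rearr:
  assumes "rearr_exists x" "decseq (A j)" "\<And>k. 0 \<le> A j k"
    and "summable (\<lambda>k. A j k * x k)" "summable (\<lambda>k. A j k * rearr x k)"
  shows "\<bar>mat_apply A x j\<bar> \<le> mat_apply A (rearr x) j"
proof -
  have "\<bar>\<Sum>k<n. A j k * x k\<bar> \<le> (\<Sum>k<n. A j k * rearr x k)" for n
  proof -
    have "\<bar>\<Sum>k<n. A j k * x k\<bar> \<le> (\<Sum>k<n. A j k * \<bar>x k\<bar>)"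
      using sum_abs[of "\<lambda>k. A j k * x k" "{..<n}"] assms(3) by (simp add: abs_mult)
    also have "\<dots> \<le> (\<Sum>k<n. A j k * rearr x k)"
      using assms by (intro sum_mult_abs_le_rearr)
    finally show ?thesis .
  qed
  then show ?thesis
    unfolding mat_apply_def using assms
    by (intro LIMSEQ_le[OF tendsto_rabs[OF summable_LIMSEQ] summable_LIMSEQ]) auto
qed

text \<open>With nonnegative terms each series is the supremum of its partial sums, so comparing
  these suffices even when the values are infinite.\<close>

lemma mat_apply_enn_le_rearr:
  assumes "rearr_exists x" "decseq (A j)" "\<And>k. 0 \<le> A j k" "\<And>k. 0 \<le> x k"
  shows "mat_apply_enn A x j \<le> mat_apply_enn A (rearr x) j"
proof -
  have "(\<Sum>k<n. ennreal (A j k * x k)) \<le> (\<Sum>k<n. ennreal (A j k * rearr x k))" for n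
    using sum_mult_abs_le_rearr[OF assms(1-3), of n] assms rearr_nonneg[OF assms(1)]
    by (simp add: ennreal_leI)
  then show ?thesis
    unfolding mat_apply_enn_def suminf_eq_SUP by (intro SUP_mono) auto
qed

lemma enn_powr_mono:
  assumes "s \<le> t" "0 \<le> p"
  shows "enn_powr s p \<le> enn_powr t p"
proof (cases "t = \<infinity>")
  case False
  then have "enn2real s \<le> enn2real t"
    using assms by (intro enn2real_mono) (auto simp: top.not_eq_extremum)
  moreover have "s \<noteq> \<infinity>"
    using False assms by (auto simp: top_unique)
  ultimately show ?thesis
    using False assms by (simp add: enn_powr_def ennreal_leI powr_mono2)
qed (simp add: enn_powr_def)

lemma lp_norm_mono:
  assumes "\<And>k. y k \<le> z k" "0 \<le> p"
  shows "lp_norm p v y \<le> lp_norm p v z"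
  unfolding lp_norm_def using assms
  by (intro enn_powr_mono suminf_le mult_right_mono) auto

theorem corollary4p7:
  fixes A :: "nat \<Rightarrow> nat \<Rightarrow> real"
  assumes nonneg: "\<And>j k. 0 \<le> A j k"
    and row_decreasing: "\<And>j k. A j (Suc k) \<le> A j k"
  shows
    "(\<forall>E nE F nF.
        normed_riesz_seq_space E nE \<and> property_PS E nE \<and>
        normed_riesz_seq_space F nF \<and> property_PS F nF \<and>
        (\<forall>x\<in>F. (\<lambda>n. nF (trunc n x)) \<longlonglongrightarrow> nF x) \<and>
        defines_operator A E F
        \<longrightarrow> (\<forall>x\<in>E. (\<forall>k. 0 \<le> x k) \<longrightarrow> nF (mat_apply A x) \<le> nF (mat_apply A (rearr x))) \<and>
            op_norm A E nE nF = op_norm_decr A E nE nF)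
     \<and>
     (\<forall>(p::real) (v::nat \<Rightarrow> real) E nE.
        1 \<le> p \<and> decseq v \<and> (\<forall>k. 0 \<le> v k) \<and>
        normed_riesz_seq_space E nE \<and> property_PS E nE
        \<longrightarrow> (\<forall>x\<in>E. (\<forall>k. 0 \<le> x k) \<longrightarrow>
               lp_norm p v (mat_apply_enn A x) \<le> lp_norm p v (mat_apply_enn A (rearr x))) \<and>
            op_norm_lp A E nE p v = op_norm_lp_decr A E nE p v)"
proof (rule conjI; intro allI impI; elim conjE)
  have decr: "decseq (A j)" for j
    by (intro decseq_SucI row_decreasing)
  {
    fix E nE F nF
    assume E: "property_PS E nE" and F: "normed_riesz_seq_space F nF"
      and op: "defines_operator A E F"
    have le: "nF (mat_apply A x) \<le> nF (mat_apply A (rearr x))" if "x \<in> E" for x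
    proof (rule normed_riesz_seq_space.nrm_mono[OF F])
      note x = property_PS_rearr[OF E that]
      show "mat_apply A x \<in> F" "mat_apply A (rearr x) \<in> F"
        using op that x unfolding defines_operator_def by auto
      show "\<bar>mat_apply A x j\<bar> \<le> \<bar>mat_apply A (rearr x) j\<bar>" for j
        using op that x abs_mat_apply_le_rearr[of x A j] nonneg decr
        unfolding defines_operator_def by (meson abs_ge_self order_trans)
    qed
    have "op_norm A E nE nF \<le> op_norm_decr A E nE nF"
      unfolding op_norm_def op_norm_decr_def
    \<comment> \<open>The witness is \<open>rearr x\<close>: it is nonnegative, decreasing and again
      of norm 1, so it competes in the restricted supremum.\<close>
    proof (rule SUP_mono)
      fix x assume "x \<in> {x \<in> E. nE x = 1}"
      then have "x \<in> E" "nE x = 1" by auto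
      note x = property_PS_rearr[OF E \<open>x \<in> E\<close>]
      show "\<exists>z\<in>{x \<in> E. nE x = 1 \<and> (\<forall>k. 0 \<le> x k) \<and> decseq x}.
          ennreal (nF (mat_apply A x)) \<le> ennreal (nF (mat_apply A z))"
        using x \<open>nE x = 1\<close> le[OF \<open>x \<in> E\<close>] rearr_nonneg[OF x(1)] decseq_rearr[OF x(1)]
        by (intro bexI[of _ "rearr x"]) (auto intro: ennreal_leI)
    qed
    moreover have "op_norm_decr A E nE nF \<le> op_norm A E nE nF"
      unfolding op_norm_def op_norm_decr_def by (intro SUP_subset_mono) auto
    ultimately show "(\<forall>x\<in>E. (\<forall>k. 0 \<le> x k) \<longrightarrow>
          nF (mat_apply A x) \<le> nF (mat_apply A (rearr x))) \<and>
        op_norm A E nE nF = op_norm_decr A E nE nF"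
      using le by auto
  }
  {
    fix p :: real and v :: "nat \<Rightarrow> real" and E nE
    assume p: "1 \<le> p" and E: "property_PS E nE"
    \<comment> \<open>The coordinatewise comparison in [0, \<infinity>] is carried over by the
      monotonicity of \<open>lp_norm\<close>.\<close>
    have le: "lp_norm p v (mat_apply_enn A x) \<le> lp_norm p v (mat_apply_enn A (rearr x))"
      if "x \<in> E" "\<forall>k. 0 \<le> x k" for x
      using p that property_PS_rearr(1)[OF E] nonneg decr
      by (intro lp_norm_mono mat_apply_enn_le_rearr) auto
    have "op_norm_lp A E nE p v \<le> op_norm_lp_decr A E nE p v"
      unfolding op_norm_lp_def op_norm_lp_decr_def
    proof (rule SUP_mono)
      fix x assume "x \<in> {x \<in> E. nE x = 1 \<and> (\<forall>k. 0 \<le> x k)}"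
      then have "x \<in> E" "nE x = 1" "\<forall>k. 0 \<le> x k" by auto
      note x = property_PS_rearr[OF E \<open>x \<in> E\<close>]
      show "\<exists>z\<in>{x \<in> E. nE x = 1 \<and> (\<forall>k. 0 \<le> x k) \<and> decseq x}.
          lp_norm p v (mat_apply_enn A x) \<le> lp_norm p v (mat_apply_enn A z)"
        using x \<open>nE x = 1\<close> le[OF \<open>x \<in> E\<close> \<open>\<forall>k. 0 \<le> x k\<close>] rearr_nonneg[OF x(1)] decseq_rearr[OF x(1)]
        by (intro bexI[of _ "rearr x"]) auto
    qed
    moreover have "op_norm_lp_decr A E nE p v \<le> op_norm_lp A E nE p v"
      unfolding op_norm_lp_def op_norm_lp_decr_def by (intro SUP_subset_mono) auto
    ultimately show "(\<forall>x\<in>E. (\<forall>k. 0 \<le> x k) \<longrightarrow>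
          lp_norm p v (mat_apply_enn A x) \<le> lp_norm p v (mat_apply_enn A (rearr x))) \<and>
        op_norm_lp A E nE p v = op_norm_lp_decr A E nE p v"
      using le by auto
  }
qed

end
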